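(* Let $X,Z\subseteq\omega$ be such that $R_X$ and $R_Z$ are punctual equivalence relations and $R_X<_{pr}R_Z$. Then there exists a primitive recursive set $Y\subseteq\omega$ such that $R_X<_{pr}R_Y<_{pr}R_Z$.
   Context: A punctual equivalence relation is a primitive recursive equivalence relation with domain $\omega$ having infinitely many equivalence classes. For equivalence relations $R,S$ on $\omega$, $R\leq_{pr} S$ means that there is a primitive recursive function $f:\omega\to\omega$ such that for all $x,y\in\omega$, $x\mathrel{R}y \Leftrightarrow f(x)\mathrel{S}f(y)$; $R<_{pr}S$ means $R\leq_{pr}S$ and $S\not\leq_{pr}R$. For $X\subseteq\omega$, $R_X$ is the equivalence relation on $\omega$ given by $x\mathrel{R_X}y \Leftrightarrow (x,y\in X \text{ or } x=y)$. *)

theory Defs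
  imports Main
begin

(* prim_rec_fun n f: the restriction of f to argument lists of length n is an n-ary
   primitive recursive function.  Values of f on lists of any other length are
   irrelevant; every notion below evaluates f only on lists of length n.
   In prim_rec the recursion variable is the first argument:
   h(0, ys) = f(ys) and h(k + 1, ys) = g(k, h(k, ys), ys). *)
inductive prim_rec_fun :: "nat \<Rightarrow> (nat list \<Rightarrow> nat) \<Rightarrow> bool" where
  zero: "prim_rec_fun n (\<lambda>_. 0)"
| succ: "prim_rec_fun 1 (\<lambda>xs. Suc (xs ! 0))"
| proj: "i < n \<Longrightarrow> prim_rec_fun n (\<lambda>xs. xs ! i)"
| comp: "prim_rec_fun (length gs) f \<Longrightarrow> (\<forall>g\<in>set gs. prim_rec_fun n g) \<Longrightarrow>
    prim_rec_fun n (\<lambda>xs. f (map (\<lambda>g. g xs) gs))"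
| prim_rec: "prim_rec_fun n f \<Longrightarrow> prim_rec_fun (n + 2) g \<Longrightarrow>
    prim_rec_fun (n + 1)
      (\<lambda>xs. rec_nat (f (tl xs)) (\<lambda>k r. g (k # r # tl xs)) (hd xs))"

definition prim_rec1 :: "(nat \<Rightarrow> nat) \<Rightarrow> bool" where
  "prim_rec1 f \<longleftrightarrow> (\<exists>g. prim_rec_fun 1 g \<and> (\<forall>x. f x = g [x]))"

definition prim_rec2 :: "(nat \<Rightarrow> nat \<Rightarrow> nat) \<Rightarrow> bool" where
  "prim_rec2 f \<longleftrightarrow> (\<exists>g. prim_rec_fun 2 g \<and> (\<forall>x y. f x y = g [x, y]))"

definition prim_rec_set :: "nat set \<Rightarrow> bool" where
  "prim_rec_set A \<longleftrightarrow> prim_rec1 (\<lambda>x. if x \<in> A then 1 else 0)"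

definition prim_rec_rel :: "nat rel \<Rightarrow> bool" where
  "prim_rec_rel R \<longleftrightarrow> prim_rec2 (\<lambda>x y. if (x, y) \<in> R then 1 else 0)"

definition punctual_equiv :: "nat rel \<Rightarrow> bool" where
  "punctual_equiv R \<longleftrightarrow> equiv UNIV R \<and> prim_rec_rel R \<and> infinite (UNIV // R)"

definition pr_reducible :: "nat rel \<Rightarrow> nat rel \<Rightarrow> bool"  (infix "\<le>\<^sub>p\<^sub>r" 50) where
  "R \<le>\<^sub>p\<^sub>r S \<longleftrightarrow>
    (\<exists>f. prim_rec1 f \<and> (\<forall>x y. (x, y) \<in> R \<longleftrightarrow> (f x, f y) \<in> S))"

definition pr_strictly_reducible :: "nat rel \<Rightarrow> nat rel \<Rightarrow> bool"  (infix "<\<^sub>p\<^sub>r" 50) where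
  "R <\<^sub>p\<^sub>r S \<longleftrightarrow> R \<le>\<^sub>p\<^sub>r S \<and> \<not> S \<le>\<^sub>p\<^sub>r R"

definition collapse_rel :: "nat set \<Rightarrow> nat rel" where
  "collapse_rel X = {(x, y). (x \<in> X \<and> y \<in> X) \<or> x = y}"

end

theory Submission
  imports Defs "HOL-Library.Nat_Bijection"
begin

text \<open>For nonempty \<open>Z\<close>, a reduction from \<open>R\<^sub>X\<close> to \<open>R\<^sub>Z\<close> is in essence a primitive recursive map that is
  injective on \<open>- X\<close>, takes values in \<open>- Z\<close> there, and sends \<open>X\<close> to a point of \<open>Z\<close>. Whether such a
  map exists depends only on growth. If there is one, dominated by a monotone primitive recursive
  \<open>p\<close>, then \<open>- Z\<close> has at least as many elements up to \<open>p n\<close> as \<open>- X\<close> has up to \<open>n\<close>. Conversely,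
  under this bound the \<open>k\<close>-th element of \<open>- X\<close> can be sent to the \<open>k\<close>-th element of \<open>- Z\<close>, which a
  bounded search finds. So reducibility becomes a preorder \<open>A \<preceq> B\<close> on complements, and it remains
  to show that this preorder is dense (\<open>strictly_between_exists\<close>).

  Given \<open>A \<preceq> B\<close> but not \<open>B \<preceq> A\<close>, thin out \<open>A\<close> until it has at most as many elements as \<open>B\<close> below
  every bound (\<open>pointwise_sparser_representative\<close>). Then build \<open>C\<close> one number at a time, keeping its
  count between those of \<open>A\<close> and \<open>B\<close>, so that \<open>A \<preceq> C \<preceq> B\<close> holds automatically. The
  construction alternates between two kinds of phases: let \<open>C\<close> catch up with \<open>B\<close> until a witness
  against \<open>C \<preceq> A\<close> via the \<open>e\<close>-th bound has appeared, and let \<open>C\<close> fall back to \<open>A\<close> until a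
  witness against \<open>B \<preceq> C\<close> via the \<open>e\<close>-th bound has appeared. A phase that never ended would make
  \<open>C\<close> grow like \<open>B\<close> while \<open>C \<preceq> A\<close>, or like \<open>A\<close> while \<open>B \<preceq> C\<close>; both contradict the assumption
  that \<open>B \<preceq> A\<close> fails. Hence every phase ends and all requirements are met.

  The bounds must be listed uniformly, yet no primitive recursive function enumerates all primitive
  recursive ones. An Ackermann-like hierarchy \<open>fast e\<close> suffices, because every primitive recursive
  function is dominated by some level (\<open>prim_rec_fun_dominated\<close>), while the graph \<open>fast e x = y\<close> is
  primitive recursive in all three variables (\<open>pr_pred_fast_eq\<close>). A witness can then be recognised
  primitively recursively, only possibly much later than where it occurs. Since a stage refers
  to the whole of \<open>C\<close> built so far, \<open>C\<close> is primitive recursive by course-of-values recursion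
  (\<open>course_of_values_set\<close>).\<close>

section \<open>Primitive recursive functions of an environment\<close>

text \<open>Closure proofs by unification are convenient when variables have no arity. A function is
  therefore taken to depend on an environment \<open>v\<close> that assigns a value to each variable, of which
  only finitely many matter. Binding a variable then amounts to shifting the environment, as in
  \<open>\<lambda>i. v (Suc i)\<close>, and the shift disappears by beta reduction.\<close>

definition pr_fun :: "((nat \<Rightarrow> nat) \<Rightarrow> nat) \<Rightarrow> bool" where
  "pr_fun f \<longleftrightarrow> (\<exists>n g. prim_rec_fun n g \<and> (\<forall>v. f v = g (map v [0..<n])))"

definition pr_pred :: "((nat \<Rightarrow> nat) \<Rightarrow> bool) \<Rightarrow> bool" where
  "pr_pred P \<longleftrightarrow> pr_fun (\<lambda>v. of_bool (P v))"

lemma pr_fun_raise_arity: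
  assumes "pr_fun f"
  obtains n where "\<And>m. n \<le> m \<Longrightarrow> \<exists>g. prim_rec_fun m g \<and> (\<forall>v. f v = g (map v [0..<m]))"
proof -
  obtain n g where g: "prim_rec_fun n g" "\<And>v. f v = g (map v [0..<n])"
    using assms by (auto simp: pr_fun_def)
  have "\<exists>g. prim_rec_fun m g \<and> (\<forall>v. f v = g (map v [0..<m]))" if "n \<le> m" for m
  proof -
    let ?gs = "map (\<lambda>i xs. xs ! i) [0..<n] :: (nat list \<Rightarrow> nat) list"
    have "prim_rec_fun m (\<lambda>xs. g (map (\<lambda>h. h xs) ?gs))"
      using g(1) that by (intro prim_rec_fun.comp) (auto intro: prim_rec_fun.proj)
    moreover have "f v = g (map (\<lambda>h. h (map v [0..<m])) ?gs)" for v
      unfolding g(2) using that by (intro arg_cong[of _ _ g]) simp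
    ultimately show ?thesis by blast
  qed
  then show thesis by (rule that)
qed

lemma pr_fun_subst:
  assumes f: "pr_fun f" and \<sigma>: "\<And>i. pr_fun (\<sigma> i)"
  shows "pr_fun (\<lambda>v. f (\<lambda>i. \<sigma> i v))"
proof -
  obtain n g where g: "prim_rec_fun n g" "\<And>v. f v = g (map v [0..<n])"
    using f by (auto simp: pr_fun_def)
  have "\<exists>k. \<forall>m\<ge>k. \<exists>h. prim_rec_fun m h \<and> (\<forall>v. \<sigma> i v = h (map v [0..<m]))" for i
    by (rule pr_fun_raise_arity[OF \<sigma>[of i]]) blast
  then have "\<exists>k. \<forall>i. \<forall>m\<ge>k i. \<exists>h. prim_rec_fun m h \<and> (\<forall>v. \<sigma> i v = h (map v [0..<m]))"
    by (intro choice allI)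
  then obtain k where
    k: "\<And>i m. k i \<le> m \<Longrightarrow> \<exists>h. prim_rec_fun m h \<and> (\<forall>v. \<sigma> i v = h (map v [0..<m]))"
    by blast
  define m where "m = (\<Sum>i<n. k i)"
  have "k i \<le> m" if "i < n" for i
    unfolding m_def using that by (intro member_le_sum) auto
  then have "\<forall>i. \<exists>h. i < n \<longrightarrow> prim_rec_fun m h \<and> (\<forall>v. \<sigma> i v = h (map v [0..<m]))"
    using k by blast
  then have "\<exists>h. \<forall>i. i < n \<longrightarrow> prim_rec_fun m (h i) \<and> (\<forall>v. \<sigma> i v = h i (map v [0..<m]))"
    by (rule choice)
  then obtain h where
    h: "\<And>i. i < n \<Longrightarrow> prim_rec_fun m (h i)"
       "\<And>i v. i < n \<Longrightarrow> \<sigma> i v = h i (map v [0..<m])"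
    by blast
  have "prim_rec_fun m (\<lambda>xs. g (map (\<lambda>h. h xs) (map h [0..<n])))"
    using g(1) h(1) by (intro prim_rec_fun.comp) auto
  moreover have "f (\<lambda>i. \<sigma> i v) = g (map (\<lambda>h. h (map v [0..<m])) (map h [0..<n]))" for v
    unfolding g(2) using h(2) by (intro arg_cong[of _ _ g]) simp
  ultimately show ?thesis
    unfolding pr_fun_def by blast
qed

lemma pr_fun_var: "pr_fun (\<lambda>v. v i)"
  unfolding pr_fun_def
proof (intro exI conjI)
  show "prim_rec_fun (Suc i) (\<lambda>xs. xs ! i)"
    by (rule prim_rec_fun.proj) simp
qed (simp del: upt_Suc)

lemma pr_fun_rename: "pr_fun f \<Longrightarrow> pr_fun (\<lambda>v. f (\<lambda>i. v (s i)))"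
  using pr_fun_subst[of f "\<lambda>i v. v (s i)"] by (simp add: pr_fun_var)

lemma pr_fun_subst2:
  assumes "pr_fun (\<lambda>v. f (v 0) (v 1))" and "pr_fun a" "pr_fun b"
  shows "pr_fun (\<lambda>v. f (a v) (b v))"
  using pr_fun_subst[OF assms(1), of "\<lambda>i. if i = 0 then a else b"] assms(2,3) by simp

lemma pr_fun_subst1:
  assumes "pr_fun (\<lambda>v. f (v 0))" and "pr_fun a"
  shows "pr_fun (\<lambda>v. f (a v))"
  using pr_fun_subst[OF assms(1), of "\<lambda>_. a"] assms(2) by simp

lemma pr_fun_Suc:
  assumes "pr_fun a"
  shows "pr_fun (\<lambda>v. Suc (a v))"
proof (rule pr_fun_subst1[OF _ assms])
  show "pr_fun (\<lambda>v. Suc (v 0))"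
    unfolding pr_fun_def
  proof (intro exI conjI)
    show "prim_rec_fun 1 (\<lambda>xs. Suc (xs ! 0))"
      by (rule prim_rec_fun.succ)
  qed simp
qed

lemma pr_fun_const: "pr_fun (\<lambda>v. c)"
proof (induction c)
  case 0
  show ?case
    unfolding pr_fun_def by (intro exI conjI) (rule prim_rec_fun.zero, simp)
qed (rule pr_fun_Suc)

text \<open>The step function sees the recursion counter as variable 0, the accumulated value as variable 1,
  and the outer environment shifted by two.\<close>

lemma pr_fun_rec:
  assumes a: "pr_fun a" and k: "pr_fun k"
    and g: "pr_fun (\<lambda>v. g (v 0) (v (Suc 0)) (\<lambda>i. v (Suc (Suc i))))"
  shows "pr_fun (\<lambda>v. rec_nat (a v) (\<lambda>j r. g j r v) (k v))"
proof -
  obtain n1 where n1: "\<And>m. n1 \<le> m \<Longrightarrow> \<exists>h. prim_rec_fun m h \<and> (\<forall>v. a v = h (map v [0..<m]))"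
    by (rule pr_fun_raise_arity[OF a]) blast
  obtain n2 where n2: "\<And>m. n2 \<le> m \<Longrightarrow> \<exists>h. prim_rec_fun m h \<and>
      (\<forall>v. g (v 0) (v (Suc 0)) (\<lambda>i. v (Suc (Suc i))) = h (map v [0..<m]))"
    by (rule pr_fun_raise_arity[OF g]) blast
  define m where "m = n1 + n2"
  obtain h1 where h1: "prim_rec_fun m h1" "\<And>v. a v = h1 (map v [0..<m])"
    using n1[of m] by (auto simp: m_def)
  obtain h2 where h2: "prim_rec_fun (m + 2) h2"
    "\<And>v. g (v 0) (v (Suc 0)) (\<lambda>i. v (Suc (Suc i))) = h2 (map v [0..<m + 2])"
    using n2[of "m + 2"] by (auto simp: m_def)
  let ?f = "\<lambda>w. rec_nat (a (\<lambda>i. w (Suc i))) (\<lambda>j r. g j r (\<lambda>i. w (Suc i))) (w 0)"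
  have "?f w = rec_nat (h1 (tl (map w [0..<m + 1])))
      (\<lambda>j r. h2 (j # r # tl (map w [0..<m + 1]))) (hd (map w [0..<m + 1]))" for w
  proof -
    have tl: "tl (map w [0..<m + 1]) = map (\<lambda>i. w (Suc i)) [0..<m]"
      by (simp add: map_upt_Suc del: upt_Suc)
    have hd: "hd (map w [0..<m + 1]) = w 0"
      by (simp add: map_upt_Suc del: upt_Suc)
    have "g j r (\<lambda>i. w (Suc i)) = h2 (j # r # map (\<lambda>i. w (Suc i)) [0..<m])" for j r
      using h2(2)[of "case_nat j (case_nat r (\<lambda>i. w (Suc i)))"]
      by (simp add: map_upt_Suc del: upt_Suc)
    then show ?thesis
      by (simp only: tl hd h1(2))
  qed
  then have "pr_fun ?f"
    unfolding pr_fun_def using prim_rec_fun.prim_rec[OF h1(1) h2(1)] by blast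
  then have "pr_fun (\<lambda>v. ?f (\<lambda>i. (case i of 0 \<Rightarrow> k | Suc j \<Rightarrow> (\<lambda>v. v j)) v))"
    by (rule pr_fun_subst) (auto split: nat.split intro: k pr_fun_var)
  then show ?thesis
    by simp
qed

lemma prim_rec1_iff_pr_fun: "prim_rec1 f \<longleftrightarrow> pr_fun (\<lambda>v. f (v 0))"
proof
  assume "prim_rec1 f"
  then show "pr_fun (\<lambda>v. f (v 0))"
    unfolding prim_rec1_def pr_fun_def by (auto intro!: exI[of _ 1])
next
  assume "pr_fun (\<lambda>v. f (v 0))"
  then obtain n g where g: "prim_rec_fun n g" "\<And>v. f (v 0) = g (map v [0..<n])"
    by (auto simp: pr_fun_def)
  let ?gs = "replicate n (\<lambda>xs. xs ! 0) :: (nat list \<Rightarrow> nat) list"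
  have "prim_rec_fun 1 (\<lambda>xs. g (map (\<lambda>h. h xs) ?gs))"
    using g(1) by (intro prim_rec_fun.comp) (auto intro: prim_rec_fun.proj)
  moreover have "f x = g (map (\<lambda>h. h [x]) ?gs)" for x
    using g(2)[of "\<lambda>_. x"] by (simp add: map_replicate_const)
  ultimately show "prim_rec1 f"
    unfolding prim_rec1_def by blast
qed

lemma prim_rec_set_iff_pr_pred: "prim_rec_set S \<longleftrightarrow> pr_pred (\<lambda>v. v 0 \<in> S)"
  by (simp add: prim_rec_set_def prim_rec1_iff_pr_fun pr_pred_def of_bool_def)

lemma pr_fun_if_prim_rec2: "prim_rec2 f \<Longrightarrow> pr_fun (\<lambda>v. f (v 0) (v 1))"
  unfolding prim_rec2_def pr_fun_def by (auto intro!: exI[of _ 2] simp: numeral_2_eq_2)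

section \<open>Closure of the primitive recursive functions and predicates\<close>

lemma pr_fun_add:
  assumes "pr_fun a" "pr_fun b" shows "pr_fun (\<lambda>v. a v + b v)"
proof -
  have "x + y = rec_nat x (\<lambda>_ r. Suc r) y" for x y :: nat
    by (induction y) auto
  then show ?thesis
    by (simp only:) (intro pr_fun_rec pr_fun_Suc pr_fun_var assms)
qed

lemma pr_fun_mult:
  assumes "pr_fun a" "pr_fun b" shows "pr_fun (\<lambda>v. a v * b v)"
proof -
  have "x * y = rec_nat 0 (\<lambda>_ r. r + x) y" for x y :: nat
    by (induction y) auto
  moreover have "pr_fun (\<lambda>v. a (\<lambda>i. v (Suc (Suc i))))"
    by (rule pr_fun_rename[OF assms(1)])
  ultimately show ?thesis
    by (simp only:) (intro pr_fun_rec pr_fun_add pr_fun_const pr_fun_var assms)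
qed

lemma pr_fun_power:
  assumes "pr_fun a" "pr_fun b" shows "pr_fun (\<lambda>v. a v ^ b v)"
proof -
  have "x ^ y = rec_nat 1 (\<lambda>_ r. x * r) y" for x y :: nat
    by (induction y) auto
  moreover have "pr_fun (\<lambda>v. a (\<lambda>i. v (Suc (Suc i))))"
    by (rule pr_fun_rename[OF assms(1)])
  ultimately show ?thesis
    by (simp only:) (intro pr_fun_rec pr_fun_mult pr_fun_const pr_fun_var assms)
qed

lemma pr_fun_diff:
  assumes "pr_fun a" "pr_fun b" shows "pr_fun (\<lambda>v. a v - b v)"
proof -
  have pred: "rec_nat 0 (\<lambda>j _. j) x = x - 1" for x :: nat
    by (cases x) auto
  have "x - y = rec_nat x (\<lambda>_. rec_nat 0 (\<lambda>j _. j)) y" for x y :: nat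
    by (induction y) (auto simp: pred)
  then show ?thesis
    by (simp only:) (intro pr_fun_rec pr_fun_var pr_fun_const assms)
qed

lemma pr_fun_of_bool: "pr_pred P \<Longrightarrow> pr_fun (\<lambda>v. of_bool (P v))"
  by (simp add: pr_pred_def)

lemma pr_pred_less:
  assumes "pr_fun a" "pr_fun b" shows "pr_pred (\<lambda>v. a v < b v)"
proof -
  have "of_bool (x < y) = 1 - (1 - (y - x))" for x y :: nat
    by auto
  then show ?thesis
    unfolding pr_pred_def
    by (simp only:) (intro pr_fun_diff pr_fun_const assms)
qed

lemma pr_pred_not:
  assumes "pr_pred P" shows "pr_pred (\<lambda>v. \<not> P v)"
proof -
  have "of_bool (\<not> p) = (1::nat) - of_bool p" for p
    by auto
  then show ?thesis
    using assms unfolding pr_pred_def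
    by (simp only:) (intro pr_fun_diff pr_fun_const)
qed

lemma pr_pred_conj:
  assumes "pr_pred P" "pr_pred Q" shows "pr_pred (\<lambda>v. P v \<and> Q v)"
  using pr_fun_mult[OF assms[unfolded pr_pred_def]] by (simp add: pr_pred_def of_bool_conj)

lemma pr_pred_eq:
  assumes "pr_fun a" "pr_fun b" shows "pr_pred (\<lambda>v. a v = b v)"
proof -
  have "pr_pred (\<lambda>v. \<not> a v < b v \<and> \<not> b v < a v)"
    by (intro pr_pred_conj pr_pred_not pr_pred_less assms)
  moreover have "\<not> x < y \<and> \<not> y < x \<longleftrightarrow> x = y" for x y :: nat
    by auto
  ultimately show ?thesis
    by (simp only:)
qed

lemma pr_pred_le:
  assumes "pr_fun a" "pr_fun b" shows "pr_pred (\<lambda>v. a v \<le> b v)"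
  using pr_pred_not[OF pr_pred_less[OF assms(2,1)]] by (simp add: not_less)

lemma pr_fun_if:
  assumes "pr_pred P" "pr_fun a" "pr_fun b"
  shows "pr_fun (\<lambda>v. if P v then a v else b v)"
proof -
  have "(if p then x else y) = of_bool p * x + of_bool (\<not> p) * y" for p and x y :: nat
    by auto
  then show ?thesis
    by (simp only:) (intro pr_fun_add pr_fun_mult pr_fun_of_bool pr_pred_not assms)
qed

lemma pr_pred_if:
  assumes "pr_pred P" "pr_pred Q" "pr_pred R"
  shows "pr_pred (\<lambda>v. if P v then Q v else R v)"
proof -
  have "of_bool (if p then q else r) = (if p then of_bool q else of_bool r :: nat)" for p q r
    by simp
  then show ?thesis
    using assms unfolding pr_pred_def by (simp only:) (intro pr_fun_if, auto simp: pr_pred_def)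
qed

lemma pr_fun_sum:
  assumes k: "pr_fun k" and f: "pr_fun (\<lambda>v. f (v 0) (\<lambda>i. v (Suc i)))"
  shows "pr_fun (\<lambda>v. \<Sum>i<k v. f i v)"
proof -
  have "(\<Sum>i<n. f i v) = rec_nat 0 (\<lambda>j r. r + f j v) n" for n v
    by (induction n) auto
  moreover have "pr_fun (\<lambda>v. f (v 0) (\<lambda>i. v (Suc (Suc i))))"
    using pr_fun_rename[OF f, of "case_nat 0 (\<lambda>i. Suc (Suc i))"] by simp
  ultimately show ?thesis
    by (simp only:) (intro pr_fun_rec pr_fun_add pr_fun_const pr_fun_var k)
qed

lemma pr_pred_bounded_ex:
  assumes k: "pr_fun k" and P: "pr_pred (\<lambda>v. P (v 0) (\<lambda>i. v (Suc i)))"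
  shows "pr_pred (\<lambda>v. \<exists>i<k v. P i v)"
proof -
  have eq: "(\<exists>i<n. P i v) \<longleftrightarrow> 0 < (\<Sum>i<n. of_bool (P i v) :: nat)" for n v
    by (auto simp: zero_less_iff_neq_zero)
  show ?thesis
    unfolding eq by (intro pr_pred_less pr_fun_const pr_fun_sum pr_fun_of_bool k P)
qed

lemma pr_fun_div:
  assumes "pr_fun a" "pr_fun b" shows "pr_fun (\<lambda>v. a v div b v)"
proof -
  have div: "x div y = (if y = 0 then 0 else \<Sum>i<x. of_bool (Suc i * y \<le> x))" for x y :: nat
  proof (cases "y = 0")
    case False
    then have "Suc i * y \<le> x \<longleftrightarrow> i < x div y" for i
      by (simp add: less_eq_div_iff_mult_less_eq Suc_le_eq[symmetric] del: mult_Suc)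
    moreover have "i < x" if "i < x div y" for i
      using that div_le_dividend[of x y] by linarith
    ultimately have "{i. i < x \<and> Suc i * y \<le> x} = {..<x div y}"
      by blast
    then have "card {i. i < x \<and> Suc i * y \<le> x} = x div y"
      by simp
    then show ?thesis
      using False by (simp add: sum.If_cases of_bool_def Int_def conj_commute del: mult_Suc)
  qed simp
  have shift: "pr_fun (\<lambda>v. a (\<lambda>i. v (Suc i)))" "pr_fun (\<lambda>v. b (\<lambda>i. v (Suc i)))"
    by (rule pr_fun_rename[OF assms(1)], rule pr_fun_rename[OF assms(2)])
  show ?thesis
    unfolding div
    by (intro pr_fun_if pr_pred_eq pr_fun_sum pr_fun_of_bool pr_pred_le pr_fun_mult pr_fun_Suc
        pr_fun_var pr_fun_const shift assms)
qed

lemma pr_fun_mod: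
  assumes "pr_fun a" "pr_fun b" shows "pr_fun (\<lambda>v. a v mod b v)"
  unfolding modulo_nat_def by (intro pr_fun_diff pr_fun_mult pr_fun_div assms)

lemma pr_pred_even:
  assumes "pr_fun a" shows "pr_pred (\<lambda>v. even (a v))"
  unfolding even_iff_mod_2_eq_zero by (intro pr_pred_eq pr_fun_mod pr_fun_const assms)

lemma pr_fun_min:
  assumes "pr_fun a" "pr_fun b" shows "pr_fun (\<lambda>v. min (a v) (b v))"
  unfolding min_def by (intro pr_fun_if pr_pred_le assms)

lemma pr_fun_funpow:
  assumes a: "pr_fun a" and k: "pr_fun k" and f: "pr_fun (\<lambda>v. f (v 0) (\<lambda>i. v (Suc i)))"
  shows "pr_fun (\<lambda>v. ((\<lambda>x. f x v) ^^ k v) (a v))"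
proof -
  have "((\<lambda>x. f x v) ^^ n) x = rec_nat x (\<lambda>_ r. f r v) n" for n x v
    by (induction n) auto
  moreover have "pr_fun (\<lambda>v. f (v (Suc 0)) (\<lambda>i. v (Suc (Suc i))))"
    using pr_fun_rename[OF f, of Suc] .
  ultimately show ?thesis
    by (simp only:) (intro pr_fun_rec a k)
qed

lemma pr_pred_mem: "prim_rec_set S \<Longrightarrow> pr_fun a \<Longrightarrow> pr_pred (\<lambda>v. a v \<in> S)"
  unfolding prim_rec_set_iff_pr_pred pr_pred_def by (rule pr_fun_subst1)

lemma prim_rec_set_Compl: "prim_rec_set S \<Longrightarrow> prim_rec_set (- S)"
  unfolding prim_rec_set_iff_pr_pred by (simp add: pr_pred_not)

section \<open>A hierarchy dominating the primitive recursive functions\<close>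

text \<open>Iterating \<open>x + 2\<close> times, rather than \<open>x\<close> times, starting from \<open>x\<close> itself, is what makes the
  closure properties immediate: one more level absorbs both the composition \<open>fast e (fast e x)\<close>
  and an iteration whose length is at most \<open>x + 2\<close>.\<close>

primrec fast :: "nat \<Rightarrow> nat \<Rightarrow> nat" where
  "fast 0 = Suc"
| "fast (Suc e) = (\<lambda>x. (fast e ^^ Suc (Suc x)) x)"

lemma funpow_add_le:
  fixes f :: "nat \<Rightarrow> nat"
  assumes "\<And>x. x < f x"
  shows "x + n \<le> (f ^^ n) x"
proof (induction n)
  case (Suc n)
  then show ?case using assms[of "(f ^^ n) x"] by simp
qed simp

lemma funpow_mono_count:
  fixes f :: "nat \<Rightarrow> nat"
  assumes "\<And>x. x < f x" and "m \<le> n"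
  shows "(f ^^ m) x \<le> (f ^^ n) x"
  using assms(2)
proof (induction rule: dec_induct)
  case (step n)
  then show ?case using assms(1)[of "(f ^^ n) x"] by simp
qed simp

lemma less_fast: "x < fast e x"
proof (induction e arbitrary: x)
  case (Suc e)
  show ?case
    using funpow_add_le[OF Suc, of x "Suc (Suc x)"] by simp
qed simp

lemma le_fast: "x \<le> fast e x"
  using less_fast[of x e] by simp

lemma strict_mono_fast: "strict_mono (fast e)"
proof (induction e)
  case 0
  show ?case by (simp add: strict_mono_def)
next
  case (Suc e)
  have "fast (Suc e) x < fast (Suc e) (Suc x)" for x
  proof -
    have "strict_mono (fast e ^^ n)" for n
      using Suc by (induction n) (auto simp: strict_mono_def)
    then have "(fast e ^^ Suc (Suc x)) x < (fast e ^^ Suc (Suc x)) (Suc x)"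
      by (simp add: strict_mono_def del: funpow.simps)
    also have "\<dots> \<le> (fast e ^^ Suc (Suc (Suc x))) (Suc x)"
      by (rule funpow_mono_count) (simp_all add: less_fast)
    finally show ?thesis by (simp del: funpow.simps)
  qed
  then show ?case unfolding strict_mono_Suc_iff by blast
qed

lemma fast_mono: "x \<le> y \<Longrightarrow> fast e x \<le> fast e y"
  using strict_mono_fast strict_mono_less_eq by blast

lemma fast_fast_le: "fast e (fast e x) \<le> fast (Suc e) x"
  using funpow_mono_count[of "fast e" 2 "Suc (Suc x)" x]
  by (simp add: less_fast numeral_2_eq_2)

lemma fast_le_fast: "d \<le> e \<Longrightarrow> fast d x \<le> fast e x"
proof (induction rule: dec_induct)
  case (step e)
  have "fast e x \<le> fast e (fast e x)" by (rule le_fast)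
  also note fast_fast_le
  finally show ?case using step.IH by simp
qed simp

lemma fast_comp_le: "fast d (fast e x) \<le> fast (Suc (max d e)) x"
proof -
  have "fast d (fast e x) \<le> fast (max d e) (fast e x)"
    by (rule fast_le_fast) simp
  also have "\<dots> \<le> fast (max d e) (fast (max d e) x)"
    by (intro fast_mono fast_le_fast) simp
  finally show ?thesis using fast_fast_le order_trans by blast
qed

lemma add_le_fast: "x + e \<le> fast e x"
proof (induction e)
  case (Suc e)
  then show ?case
    using less_fast[of "fast e x" e] fast_fast_le[of e x] by linarith
qed simp

text \<open>The bound is formulated for an arbitrary common bound \<open>m\<close> of the arguments, so that the induction
  hypotheses compose directly. Composition costs one level by \<open>fast_comp_le\<close>. In a primitive
  recursion over \<open>k \<le> m\<close> each step applies at most one further \<open>fast e\<close> to the current bound, so the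
  result is at most \<open>(fast e ^^ Suc k) m\<close>, hence at most \<open>fast (Suc e) m\<close>.\<close>

lemma prim_rec_fun_dominated:
  assumes "prim_rec_fun n f"
  shows "\<exists>e. \<forall>xs m. length xs = n \<longrightarrow> (\<forall>x\<in>set xs. x \<le> m) \<longrightarrow> f xs \<le> fast e m"
  using assms
proof (induction rule: prim_rec_fun.induct)
  case (zero n)
  show ?case by simp
next
  case succ
  have "Suc (xs ! 0) \<le> fast 0 m" if "length xs = 1" "\<forall>x\<in>set xs. x \<le> m" for xs m
    using that by simp
  then show ?case by blast
next
  case (proj i n)
  have "xs ! i \<le> fast 0 m" if "length xs = n" "\<forall>x\<in>set xs. x \<le> m" for xs m
    using that proj by (simp add: le_SucI)
  then show ?case by blast
next
  case (comp gs f n)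
  then obtain d where
    d: "\<And>xs m. length xs = length gs \<Longrightarrow> \<forall>x\<in>set xs. x \<le> m \<Longrightarrow> f xs \<le> fast d m"
    by blast
  have "\<forall>g\<in>set gs. \<exists>e. \<forall>xs m. length xs = n \<longrightarrow> (\<forall>x\<in>set xs. x \<le> m) \<longrightarrow> g xs \<le> fast e m"
    using comp by blast
  then obtain lev where lev: "\<And>g xs m. g \<in> set gs \<Longrightarrow> length xs = n \<Longrightarrow> \<forall>x\<in>set xs. x \<le> m \<Longrightarrow>
      g xs \<le> fast (lev g) m"
    by (auto dest!: bchoice)
  define e where "e = Max (insert 0 (lev ` set gs))"
  have le_e: "lev g \<le> e" if "g \<in> set gs" for g
    using that by (simp add: e_def)
  have "f (map (\<lambda>g. g xs) gs) \<le> fast (Suc (max d e)) m"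
    if xs: "length xs = n" "\<forall>x\<in>set xs. x \<le> m" for xs m
  proof -
    have "g xs \<le> fast e m" if "g \<in> set gs" for g
      using lev[OF that xs] fast_le_fast[OF le_e[OF that]] order_trans by blast
    then have "f (map (\<lambda>g. g xs) gs) \<le> fast d (fast e m)"
      by (intro d) auto
    then show ?thesis
      using fast_comp_le order_trans by blast
  qed
  then show ?case by blast
next
  case (prim_rec n f g)
  then obtain d1 d2 where
    d1: "\<And>xs m. length xs = n \<Longrightarrow> \<forall>x\<in>set xs. x \<le> m \<Longrightarrow> f xs \<le> fast d1 m" and
    d2: "\<And>xs m. length xs = n + 2 \<Longrightarrow> \<forall>x\<in>set xs. x \<le> m \<Longrightarrow> g xs \<le> fast d2 m"
    by metis
  define e where "e = max d1 d2"
  have "rec_nat (f (tl xs)) (\<lambda>k r. g (k # r # tl xs)) (hd xs) \<le> fast (Suc e) m"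
    if xs: "length xs = n + 1" "\<forall>x\<in>set xs. x \<le> m" for xs m
  proof -
    obtain k ys where xs_eq: "xs = k # ys" and ys: "length ys = n" "\<forall>y\<in>set ys. y \<le> m" and "k \<le> m"
      using xs by (cases xs) auto
    have "rec_nat (f ys) (\<lambda>k r. g (k # r # ys)) j \<le> (fast e ^^ Suc j) m" if "j \<le> m" for j
      using that
    proof (induction j)
      case 0
      have "f ys \<le> fast d1 m" by (rule d1[OF ys])
      also have "\<dots> \<le> fast e m" by (rule fast_le_fast) (simp add: e_def)
      finally show ?case by simp
    next
      case (Suc j)
      let ?r = "rec_nat (f ys) (\<lambda>k r. g (k # r # ys)) j"
      let ?b = "(fast e ^^ Suc j) m"
      have "m \<le> ?b"
        using funpow_add_le[of "fast e" m "Suc j", OF less_fast] by linarith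
      then have "\<forall>x\<in>set (j # ?r # ys). x \<le> ?b"
        using Suc ys(2) by (auto simp del: funpow.simps)
      then have "g (j # ?r # ys) \<le> fast d2 ?b"
        by (intro d2) (simp_all add: ys)
      also have "\<dots> \<le> fast e ?b" by (rule fast_le_fast) (simp add: e_def)
      finally show ?case by simp
    qed
    from this[OF \<open>k \<le> m\<close>] have "rec_nat (f ys) (\<lambda>k r. g (k # r # ys)) k \<le> (fast e ^^ Suc k) m" .
    also have "\<dots> \<le> (fast e ^^ Suc (Suc m)) m"
      by (rule funpow_mono_count) (use \<open>k \<le> m\<close> in \<open>simp_all add: less_fast\<close>)
    finally show ?thesis by (simp add: xs_eq)
  qed
  then show ?case by blast
qed

corollary prim_rec1_dominated:
  assumes "prim_rec1 f"
  obtains e where "\<And>x. f x \<le> fast e x"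
proof -
  obtain g where g: "prim_rec_fun 1 g" "\<And>x. f x = g [x]"
    using assms by (auto simp: prim_rec1_def)
  obtain e where "\<And>xs m. length xs = 1 \<Longrightarrow> \<forall>x\<in>set xs. x \<le> m \<Longrightarrow> g xs \<le> fast e m"
    using prim_rec_fun_dominated[OF g(1)] by blast
  then have "f x \<le> fast e x" for x by (simp add: g(2))
  then show thesis by (rule that)
qed

lemma pr_fun_fast:
  assumes "pr_fun a" shows "pr_fun (\<lambda>v. fast e (a v))"
proof -
  have "pr_fun (\<lambda>v. fast e (v 0))"
  proof (induction e)
    case (Suc e)
    have "pr_fun (\<lambda>v. (fast e ^^ Suc (Suc (v 0))) (v 0))"
      by (intro pr_fun_funpow Suc pr_fun_Suc pr_fun_var)
    then show ?case by (simp del: funpow.simps)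
  qed (simp add: pr_fun_Suc pr_fun_var)
  then show ?thesis using assms by (rule pr_fun_subst1)
qed

section \<open>The graph of the hierarchy\<close>

definition digit :: "nat \<Rightarrow> nat \<Rightarrow> nat \<Rightarrow> nat" where
  "digit b t i = t div b ^ i mod b"

lemma sum_digits_less:
  assumes "\<And>i. i < n \<Longrightarrow> d i < (b::nat)"
  shows "(\<Sum>i<n. d i * b ^ i) < b ^ n"
  using assms
proof (induction n)
  case (Suc n)
  have "(\<Sum>i<Suc n. d i * b ^ i) < b ^ n + d n * b ^ n"
    using Suc by simp
  also have "\<dots> = Suc (d n) * b ^ n" by simp
  also have "\<dots> \<le> b * b ^ n"
    using Suc.prems[of n] by (intro mult_le_mono1) simp
  finally show ?case by simp
qed simp

lemma digit_sum:
  assumes "\<And>i. i < n \<Longrightarrow> d i < b" and "j < n"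
  shows "digit b (\<Sum>i<n. d i * b ^ i) j = d j"
  using assms
proof (induction n)
  case (Suc n)
  let ?S = "\<Sum>i<n. d i * b ^ i"
  have S: "?S < b ^ n" and b: "b > 0"
    using sum_digits_less[of n d b] Suc.prems by fastforce+
  show ?case
  proof (cases "j = n")
    case True
    then show ?thesis
      using S b Suc.prems by (simp add: digit_def)
  next
    case False
    then have j: "j < n" using Suc.prems by simp
    then obtain k where n: "n = j + Suc k"
      using less_iff_Suc_add by auto
    have "(?S + d n * b ^ n) div b ^ j = ?S div b ^ j + d n * b ^ Suc k"
      using b div_mult_self1[of "b ^ j" ?S "d n * b ^ Suc k"]
      by (simp add: n power_add mult_ac)
    then have "digit b (?S + d n * b ^ n) j = (?S div b ^ j + b * (d n * b ^ k)) mod b"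
      by (simp add: digit_def mult_ac)
    also have "\<dots> = digit b ?S j" by (simp add: digit_def)
    also have "\<dots> = d j" using Suc j by simp
    finally show ?thesis by simp
  qed
qed simp

text \<open>The function \<open>(e, x) \<mapsto> fast e x\<close> is not primitive recursive, but its truncation at any bound \<open>b\<close>
  is. The truncated level \<open>e\<close>, restricted to \<open>{..b}\<close>, is a finite function from \<open>{..b}\<close> to itself
  and is coded by a number in base \<open>b + 1\<close>; the table of the next level is computed from this code
  alone.\<close>

definition fast_table :: "nat \<Rightarrow> nat \<Rightarrow> nat" where
  "fast_table b e = (\<Sum>x<Suc b. min (fast e x) b * Suc b ^ x)"

lemma digit_fast_table: "x \<le> b \<Longrightarrow> digit (Suc b) (fast_table b e) x = min (fast e x) b"
  unfolding fast_table_def by (subst digit_sum) auto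

text \<open>Truncating after every step of an iteration is harmless: the levels are inflationary, so once a
  value exceeds \<open>b\<close> all later ones do, and the truncated iteration then stays at \<open>b\<close>.\<close>

lemma funpow_digit_fast_table:
  assumes "x \<le> b"
  shows "(digit (Suc b) (fast_table b e) ^^ k) x = min ((fast e ^^ k) x) b"
proof (induction k)
  case (Suc k)
  have "min (fast e (min y b)) b = min (fast e y) b" for y
    using le_fast[of b e] le_fast[of y e] by (cases "y \<le> b") auto
  then show ?case using Suc by (simp add: digit_fast_table)
qed (simp add: assms)

lemma fast_table_rec:
  "fast_table b e = rec_nat (\<Sum>x<Suc b. min (Suc x) b * Suc b ^ x)
     (\<lambda>_ t. \<Sum>x<Suc b. (digit (Suc b) t ^^ Suc (Suc x)) x * Suc b ^ x) e"
proof (induction e)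
  case 0
  show ?case by (simp add: fast_table_def)
next
  case (Suc e)
  have "fast_table b (Suc e) =
      (\<Sum>x<Suc b. (digit (Suc b) (fast_table b e) ^^ Suc (Suc x)) x * Suc b ^ x)"
    unfolding fast_table_def[of b "Suc e"]
    by (intro sum.cong refl) (simp add: funpow_digit_fast_table del: funpow.simps)
  then show ?case using Suc by simp
qed

lemma pr_fun_digit:
  assumes "pr_fun b" "pr_fun t" "pr_fun i" shows "pr_fun (\<lambda>v. digit (b v) (t v) (i v))"
  unfolding digit_def by (intro pr_fun_mod pr_fun_div pr_fun_power assms)

lemma pr_fun_fast_table:
  assumes "pr_fun b" "pr_fun e" shows "pr_fun (\<lambda>v. fast_table (b v) (e v))"
proof (rule pr_fun_subst2[OF _ assms])
  show "pr_fun (\<lambda>v. fast_table (v 0) (v 1))"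
    unfolding fast_table_rec
    by (intro pr_fun_rec pr_fun_sum pr_fun_funpow pr_fun_digit pr_fun_mult pr_fun_power pr_fun_min
        pr_fun_Suc pr_fun_var)
qed

text \<open>Whether \<open>fast e x = y\<close> can be read off the table truncated at \<open>y + 1\<close>, which distinguishes the
  value \<open>y\<close> from all larger ones.\<close>

lemma pr_pred_fast_eq:
  assumes "pr_fun e" "pr_fun x" "pr_fun y" shows "pr_pred (\<lambda>v. fast (e v) (x v) = y v)"
proof -
  have eq: "fast e x = y \<longleftrightarrow> x \<le> y \<and> digit (Suc (Suc y)) (fast_table (Suc y) e) x = y" for e x y
    using le_fast[of x e] by (auto simp: digit_fast_table min_def split: if_splits)
  show ?thesis
    unfolding eq
    by (intro pr_pred_conj pr_pred_le pr_pred_eq pr_fun_digit pr_fun_fast_table pr_fun_Suc assms)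
qed

section \<open>Counting functions and sparseness\<close>

definition count_below :: "nat set \<Rightarrow> nat \<Rightarrow> nat" where
  "count_below S n = card {x \<in> S. x < n}"

lemma count_below_0 [simp]: "count_below S 0 = 0"
  by (simp add: count_below_def)

lemma count_below_Suc [simp]: "count_below S (Suc n) = count_below S n + of_bool (n \<in> S)"
proof -
  have "{x \<in> S. x < Suc n} = (if n \<in> S then insert n {x \<in> S. x < n} else {x \<in> S. x < n})"
    by (auto simp: less_Suc_eq)
  then show ?thesis by (simp add: count_below_def)
qed

lemma count_below_eq_sum: "count_below S n = (\<Sum>x<n. of_bool (x \<in> S))"
  by (induction n) simp_all

lemma count_below_le: "count_below S n \<le> n"
  by (induction n) auto

lemma count_below_mono: "m \<le> n \<Longrightarrow> count_below S m \<le> count_below S n"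
  by (induction rule: dec_induct) auto

lemma count_below_cong:
  "(\<And>x. x < n \<Longrightarrow> x \<in> S \<longleftrightarrow> x \<in> T) \<Longrightarrow> count_below S n = count_below T n"
  by (induction n) auto

lemma count_below_UNIV: "count_below UNIV n = n"
  by (induction n) auto

lemma count_below_unbounded:
  assumes "infinite S"
  shows "\<exists>n. k \<le> count_below S n"
proof -
  obtain F where F: "F \<subseteq> S" "finite F" "card F = k"
    using infinite_arbitrarily_large[OF assms] by blast
  then obtain n where "\<forall>x\<in>F. x < n"
    using finite_nat_set_iff_bounded by blast
  then have "F \<subseteq> {x \<in> S. x < n}" using F by auto
  then have "card F \<le> count_below S n"
    unfolding count_below_def by (intro card_mono) auto
  then show ?thesis using F by auto
qed

lemma count_below_inject:
  assumes "x \<in> S" "y \<in> S" "count_below S x = count_below S y"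
  shows "x = y"
proof -
  have "\<not> u < w" if "u \<in> S" "count_below S u = count_below S w" for u w
    using count_below_mono[of "Suc u" w S] that by (auto simp: Suc_le_eq)
  then show ?thesis using assms by (metis linorder_neqE_nat)
qed

lemma pr_fun_count_below:
  assumes "pr_fun k" and "pr_pred (\<lambda>v. v 0 \<in> S (\<lambda>i. v (Suc i)))"
  shows "pr_fun (\<lambda>v. count_below (S v) (k v))"
  unfolding count_below_eq_sum by (intro pr_fun_sum pr_fun_of_bool assms)

text \<open>By domination, this says that some primitive recursive function \<open>p\<close> satisfies
  \<open>count_below A n \<le> count_below B (p n)\<close> for all \<open>n\<close>; only its level in the hierarchy is kept.\<close>

definition embeds :: "nat set \<Rightarrow> nat set \<Rightarrow> bool" (infix "\<preceq>" 50) where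
  "A \<preceq> B \<longleftrightarrow> (\<exists>e. \<forall>n. count_below A n \<le> count_below B (fast e n))"

lemma embedsI:
  assumes "\<And>n. count_below A n \<le> count_below B (fast d (fast e n))"
  shows "A \<preceq> B"
proof -
  have "count_below A n \<le> count_below B (fast (Suc (max d e)) n)" for n
    using assms count_below_mono[OF fast_comp_le] by (rule order_trans)
  then show ?thesis unfolding embeds_def by blast
qed

lemma embedsI_shift_argument:
  assumes "\<And>n. count_below A n \<le> count_below B (fast e (n + k))"
  shows "A \<preceq> B"
proof (rule embedsI)
  show "count_below A n \<le> count_below B (fast e (fast k n))" for n
    using assms count_below_mono[OF fast_mono[OF add_le_fast]] by (rule order_trans)
qed

lemma embedsI_shift_value:
  assumes "\<And>n. count_below A n \<le> count_below B (fast e n + k)"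
  shows "A \<preceq> B"
proof (rule embedsI)
  show "count_below A n \<le> count_below B (fast k (fast e n))" for n
    using assms count_below_mono[OF add_le_fast] by (rule order_trans)
qed

lemma embeds_if_le:
  assumes "\<And>n. count_below A n \<le> count_below B n"
  shows "A \<preceq> B"
  unfolding embeds_def using assms count_below_mono[OF le_fast] by (blast intro: order_trans)

lemma embeds_trans:
  assumes "A \<preceq> B" and "B \<preceq> C"
  shows "A \<preceq> C"
proof -
  obtain d e where
    d: "\<And>n. count_below A n \<le> count_below B (fast d n)" and
    e: "\<And>n. count_below B n \<le> count_below C (fast e n)"
    using assms unfolding embeds_def by blast
  show ?thesis
    using d e by (rule embedsI[OF order_trans])
qed

lemma infinite_if_embeds:
  assumes "infinite A" and "A \<preceq> B"
  shows "infinite B"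
proof
  assume "finite B"
  obtain e where e: "\<And>n. count_below A n \<le> count_below B (fast e n)"
    using \<open>A \<preceq> B\<close> unfolding embeds_def by blast
  obtain n where "Suc (card B) \<le> count_below A n"
    using count_below_unbounded[OF \<open>infinite A\<close>] by blast
  also note e
  also have "count_below B (fast e n) \<le> card B"
    unfolding count_below_def by (rule card_mono) (use \<open>finite B\<close> in auto)
  finally show False by simp
qed

text \<open>Moving each \<open>a\<close> in \<open>A\<close> out to \<open>fast e (a + 1)\<close> does not change \<open>A\<close> up to \<open>\<preceq>\<close>, and the image of a
  strictly increasing primitive recursive function that is inflationary is again primitive
  recursive. If \<open>y\<close> lies just beyond the image of \<open>a\<close>, the image has at most
  \<open>count_below A (a + 1)\<close> elements below \<open>y\<close>, and \<open>B\<close> has that many already below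
  \<open>fast e (a + 1)\<close>; this is why the argument is increased by one.\<close>

lemma pointwise_sparser_representative:
  assumes A: "prim_rec_set A" and "A \<preceq> B"
  obtains A' where "prim_rec_set A'" "A \<preceq> A'" "A' \<preceq> A"
    and "\<And>n. count_below A' n \<le> count_below B n"
proof -
  obtain e where e: "\<And>n. count_below A n \<le> count_below B (fast e n)"
    using \<open>A \<preceq> B\<close> unfolding embeds_def by blast
  define p where "p = (\<lambda>x. fast e (Suc x))"
  have p: "p x < p y \<longleftrightarrow> x < y" for x y
    using strict_mono_less[OF strict_mono_fast, of e] by (simp add: p_def)
  then have inj: "inj p"
    by (metis injI linorder_neqE_nat less_irrefl)
  have less_p: "x < p x" for x
    using less_fast[of "Suc x" e] by (simp add: p_def)
  have count: "count_below (p ` A) y = count_below A x" if "\<And>a. p a < y \<longleftrightarrow> a < x" for x y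
  proof -
    have "{z \<in> p ` A. z < y} = p ` {a \<in> A. a < x}"
      using that by auto
    then show ?thesis
      unfolding count_below_def by (simp add: card_image inj_on_subset[OF inj])
  qed
  have "p ` A = {y. \<exists>a<y. fast e (Suc a) = y \<and> a \<in> A}"
    using less_p by (auto simp: p_def)
  then have "prim_rec_set (p ` A)"
    unfolding prim_rec_set_iff_pr_pred
    by (simp only: mem_Collect_eq)
      (intro pr_pred_bounded_ex pr_pred_conj pr_pred_fast_eq pr_pred_mem pr_fun_Suc pr_fun_const
        pr_fun_var A)
  moreover have "A \<preceq> p ` A"
  proof (rule embedsI_shift_argument)
    show "count_below A n \<le> count_below (p ` A) (fast e (n + 1))" for n
      using count[of "p n" n, OF p] by (simp add: p_def)
  qed
  moreover have "count_below (p ` A) y \<le> count_below A y \<and> count_below (p ` A) y \<le> count_below B y" for y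
  proof -
    \<comment> \<open>The elements of \<open>p ` A\<close> below \<open>y\<close> are the images of the elements of \<open>A\<close> below \<open>x\<close>.\<close>
    define x where "x = (LEAST x. y \<le> p x)"
    have "y \<le> p y" using less_p[of y] by simp
    then have x: "y \<le> p x" "x \<le> y"
      unfolding x_def by (auto intro: LeastI Least_le)
    have below: "p a < y \<longleftrightarrow> a < x" for a
      using not_less_Least[of a "\<lambda>x. y \<le> p x"] x(1) p[of a x]
      by (metis leD leI less_le_trans x_def)
    have "count_below A x \<le> count_below B y"
    proof (cases x)
      case (Suc a)
      have "count_below A x \<le> count_below B (p a)"
        using e[of x] by (simp add: p_def Suc)
      also have "\<dots> \<le> count_below B y"
        using below[of a] Suc by (intro count_below_mono) simp
      finally show ?thesis .
    qed simp
    then show ?thesis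
      using count[OF below] count_below_mono[OF x(2)] by simp
  qed
  ultimately show thesis
    using that embeds_if_le by blast
qed

section \<open>Reducibility as sparseness\<close>

lemma in_collapse_rel [simp]: "(x, y) \<in> collapse_rel X \<longleftrightarrow> x \<in> X \<and> y \<in> X \<or> x = y"
  by (simp add: collapse_rel_def)

text \<open>A reduction \<open>f\<close> need not map \<open>X\<close> into \<open>Z\<close>: it may collapse \<open>X\<close> to a point outside \<open>Z\<close> and use the
  class \<open>Z\<close> for one element of \<open>- X\<close>. Exchanging these two values yields an injection of \<open>- X\<close> into
  \<open>- Z\<close>, and counting its values gives the claim.\<close>

lemma embeds_if_reducible:
  assumes "X \<noteq> {}" and "collapse_rel X \<le>\<^sub>p\<^sub>r collapse_rel Z"
  shows "- X \<preceq> - Z"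
proof -
  obtain f where f: "prim_rec1 f" "\<And>x y. (x, y) \<in> collapse_rel X \<longleftrightarrow> (f x, f y) \<in> collapse_rel Z"
    using assms(2) by (auto simp: pr_reducible_def)
  obtain e where e: "\<And>x. f x \<le> fast e x"
    using prim_rec1_dominated[OF f(1)] by blast
  obtain c where c: "c \<in> X" using assms(1) by blast
  define g where "g = (\<lambda>x. if f x \<in> Z then f c else f x)"
  have far: "\<not> (f x \<in> Z \<and> f c \<in> Z \<or> f x = f c)" if "x \<notin> X" for x
    using f(2)[of x c] that c by auto
  have not_Z: "g x \<notin> Z" if "x \<notin> X" for x
    using far[OF that] by (simp add: g_def)
  have inj: "inj_on g (- X)"
  proof (rule inj_onI)
    fix x y assume "x \<in> - X" "y \<in> - X" "g x = g y"
    then have "f x \<in> Z \<and> f y \<in> Z \<or> f x = f y"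
      using far[of x] far[of y] by (simp add: g_def split: if_splits)
    then have "(f x, f y) \<in> collapse_rel Z"
      by simp
    then have "(x, y) \<in> collapse_rel X"
      by (simp only: f(2))
    then show "x = y" using \<open>x \<in> - X\<close> by simp
  qed
  have "count_below (- X) n \<le> count_below (- Z) (fast e n + (f c + 1))" for n
  proof -
    have "g x < fast e n + (f c + 1)" if "x < n" for x
      using e[of x] fast_mono[of x n e] that by (simp add: g_def)
    then have "g ` {x \<in> - X. x < n} \<subseteq> {z \<in> - Z. z < fast e n + (f c + 1)}"
      using not_Z by auto
    then have "card (g ` {x \<in> - X. x < n}) \<le> count_below (- Z) (fast e n + (f c + 1))"
      unfolding count_below_def by (intro card_mono) auto
    moreover have "card (g ` {x \<in> - X. x < n}) = count_below (- X) n"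
      unfolding count_below_def by (intro card_image inj_on_subset[OF inj]) auto
    ultimately show ?thesis by simp
  qed
  then show ?thesis by (rule embedsI_shift_value)
qed

text \<open>The element of \<open>S\<close> with exactly \<open>k\<close> predecessors in \<open>S\<close>, found by a search below \<open>n\<close>: the numbers
  counted are precisely those smaller than it.\<close>

definition nth_below :: "nat set \<Rightarrow> nat \<Rightarrow> nat \<Rightarrow> nat" where
  "nth_below S n k = (\<Sum>y<n. of_bool (count_below S (Suc y) \<le> k))"

lemma nth_below:
  assumes "k < count_below S n"
  shows "nth_below S n k \<in> S \<and> count_below S (nth_below S n k) = k"
proof -
  define y where "y = (LEAST y. k < count_below S (Suc y))"
  obtain m where m: "n = Suc m" using assms by (cases n) auto
  have y: "k < count_below S (Suc y)" and "y \<le> m"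
    unfolding y_def using assms m by (auto intro: LeastI[of _ m] Least_le simp del: count_below_Suc)
  have less: "count_below S (Suc x) \<le> k \<longleftrightarrow> x < y" for x
  proof
    assume "count_below S (Suc x) \<le> k"
    then show "x < y" 
      using y count_below_mono[of "Suc y" "Suc x" S] by (metis Suc_le_mono leD le_trans not_le_imp_less)
  next
    assume "x < y"
    then show "count_below S (Suc x) \<le> k"
      using not_less_Least[of x "\<lambda>y. k < count_below S (Suc y)"] by (simp only: y_def not_less)
  qed
  have "nth_below S n k = card ({..<n} \<inter> {..<y})"
    unfolding nth_below_def less by (simp add: lessThan_def)
  also have "{..<n} \<inter> {..<y} = {..<y}"
    using \<open>y \<le> m\<close> m by auto
  finally have "nth_below S n k = y" by simp
  moreover have "count_below S y \<le> k"
    using less[of "y - 1"] by (cases y) auto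
  ultimately show ?thesis using y by (auto simp: of_bool_def split: if_splits)
qed

text \<open>Elements outside \<open>X\<close> are matched in increasing order with those outside \<open>Z\<close>; the embedding
  provides the bound for the search.\<close>

lemma reducible_if_embeds:
  assumes X: "prim_rec_set X" and Z: "prim_rec_set Z" and "Z \<noteq> {}" and "- X \<preceq> - Z"
  shows "collapse_rel X \<le>\<^sub>p\<^sub>r collapse_rel Z"
proof -
  obtain c where c: "c \<in> Z" using \<open>Z \<noteq> {}\<close> by blast
  obtain e where e: "\<And>n. count_below (- X) n \<le> count_below (- Z) (fast e n)"
    using \<open>- X \<preceq> - Z\<close> by (auto simp: embeds_def)
  define f where "f = (\<lambda>x. if x \<in> X then c
    else nth_below (- Z) (fast e (Suc x)) (count_below (- X) x))"
  have "prim_rec1 f"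
    unfolding prim_rec1_iff_pr_fun f_def nth_below_def
    by (intro pr_fun_if pr_pred_mem pr_fun_sum pr_fun_of_bool pr_pred_le pr_fun_count_below
        pr_fun_fast pr_fun_Suc pr_fun_var pr_fun_const prim_rec_set_Compl X Z)
  moreover have f: "f x \<in> - Z \<and> count_below (- Z) (f x) = count_below (- X) x" if "x \<notin> X" for x
    using nth_below[of "count_below (- X) x" "- Z" "fast e (Suc x)"] e[of "Suc x"] that
    by (simp add: f_def)
  have "(x, y) \<in> collapse_rel X \<longleftrightarrow> (f x, f y) \<in> collapse_rel Z" for x y
  proof -
    have "f x \<in> Z \<longleftrightarrow> x \<in> X" for x
      using f[of x] c by (auto simp: f_def)
    moreover have "x = y" if "x \<notin> X" "y \<notin> X" "f x = f y"
      using f[of x] f[of y] that count_below_inject[of x "- X" y] by simp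
    ultimately show ?thesis by (metis in_collapse_rel)
  qed
  ultimately show ?thesis by (auto simp: pr_reducible_def)
qed

text \<open>The empty set and a singleton both induce the identity relation, so the set may always be taken
  nonempty, as the correspondence with \<open>\<preceq>\<close> demands.\<close>

lemma collapse_rel_nonempty_representative:
  obtains X' where "X' \<noteq> {}" and "collapse_rel X' = collapse_rel X"
proof (cases "X = {}")
  case True
  have "collapse_rel {0} = collapse_rel X"
    using True by (auto simp: collapse_rel_def)
  then show thesis using that by blast
next
  case False
  then show thesis by (rule that) simp
qed

text \<open>Membership in \<open>X\<close> is equivalence to a fixed element of \<open>X\<close>.\<close>

lemma prim_rec_set_if_punctual:
  assumes "punctual_equiv (collapse_rel X)" and "X \<noteq> {}"
  shows "prim_rec_set X"
proof -
  obtain c where "c \<in> X" using assms(2) by blast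
  then have mem: "x \<in> X \<longleftrightarrow> (x, c) \<in> collapse_rel X" for x by auto
  have "pr_fun (\<lambda>v. of_bool ((v 0, v 1) \<in> collapse_rel X))"
    using pr_fun_if_prim_rec2 assms(1)
    by (fastforce simp: punctual_equiv_def prim_rec_rel_def of_bool_def)
  then have "pr_fun (\<lambda>v. of_bool ((v 0, c) \<in> collapse_rel X))"
    by (rule pr_fun_subst2) (rule pr_fun_var pr_fun_const)+
  then show ?thesis
    unfolding prim_rec_set_iff_pr_pred pr_pred_def mem .
qed

lemma infinite_Compl_if_punctual:
  assumes "punctual_equiv (collapse_rel X)"
  shows "infinite (- X)"
proof
  assume "finite (- X)"
  have "UNIV // collapse_rel X \<subseteq> insert X ((\<lambda>x. {x}) ` (- X))"
    by (auto simp: quotient_def collapse_rel_def)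
  then have "finite (UNIV // collapse_rel X)"
    by (rule finite_subset) (simp add: \<open>finite (- X)\<close>)
  then show False using assms by (simp add: punctual_equiv_def)
qed

section \<open>Course-of-values recursion for sets\<close>

lemma pr_pred_set_decode:
  assumes "pr_fun a" "pr_fun h" shows "pr_pred (\<lambda>v. a v \<in> set_decode (h v))"
proof -
  have "x \<in> set_decode t \<longleftrightarrow> t div 2 ^ x mod 2 = 1" for x t
    by (simp add: set_decode_def odd_iff_mod_2_eq_one)
  then show ?thesis
    by (simp only:)
      (intro pr_pred_eq pr_fun_mod pr_fun_div pr_fun_power pr_fun_const assms)
qed

text \<open>If membership of \<open>s\<close> is decided primitively recursively from the part of the set below \<open>s\<close>, the
  set is primitive recursive: the finite initial parts, coded by \<open>set_encode\<close>, are generated by an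
  ordinary recursion.\<close>

lemma course_of_values_set:
  assumes "pr_pred (\<lambda>v. \<Phi> (v 0) (set_decode (v 1)))"
  obtains C where "prim_rec_set C" and "\<And>s. s \<in> C \<longleftrightarrow> \<Phi> s (C \<inter> {..<s})"
proof -
  define h where "h = rec_nat 0 (\<lambda>s t. t + of_bool (\<Phi> s (set_decode t)) * 2 ^ s)"
  define C where "C = {s. \<Phi> s (set_decode (h s))}"
  have h: "h s = set_encode (C \<inter> {..<s})" for s
  proof (induction s)
    case 0
    show ?case by (simp add: h_def set_encode_def)
  next
    case (Suc s)
    have "h (Suc s) = h s + of_bool (s \<in> C) * 2 ^ s"
      by (simp add: h_def C_def)
    moreover have "C \<inter> {..<Suc s} = (if s \<in> C then insert s (C \<inter> {..<s}) else C \<inter> {..<s})"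
      by (auto simp: less_Suc_eq)
    ultimately show ?case
      using Suc by (simp add: set_encode_insert)
  qed
  have "s \<in> C \<longleftrightarrow> \<Phi> s (C \<inter> {..<s})" for s
    by (subst C_def) (simp add: h set_encode_inverse)
  moreover have "prim_rec_set C"
  proof -
    have \<Phi>: "pr_pred (\<lambda>v. \<Phi> (a v) (set_decode (t v)))" if "pr_fun a" "pr_fun t" for a t
      using assms that unfolding pr_pred_def by (rule pr_fun_subst2)
    show ?thesis
      unfolding prim_rec_set_iff_pr_pred C_def h_def mem_Collect_eq
      by (intro \<Phi> pr_fun_rec pr_fun_add pr_fun_mult pr_fun_power pr_fun_of_bool pr_fun_var pr_fun_const)
  qed
  ultimately show thesis using that by blast
qed

section \<open>A set strictly between two sets of different growth\<close>

text \<open>Requirement \<open>2 * e\<close> is that \<open>fast e\<close> does not establish \<open>C \<preceq> A\<close>, and requirement \<open>2 * e + 1\<close>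
  that it does not establish \<open>B \<preceq> C\<close>. A witness counts at stage \<open>s\<close> only if both \<open>x\<close> and \<open>fast e x\<close>
  are below \<open>s\<close>; this keeps the search bounded and makes the test refer to \<open>C\<close> below \<open>s\<close> only.\<close>

definition witnessed :: "nat set \<Rightarrow> nat set \<Rightarrow> nat set \<Rightarrow> nat \<Rightarrow> nat \<Rightarrow> bool" where
  "witnessed A B C s r \<longleftrightarrow> (\<exists>x<s. \<exists>y<s. fast (r div 2) x = y \<and>
     (if even r then count_below A y < count_below C x else count_below C y < count_below B x))"

text \<open>The least requirement not yet known to be met, when requirements are attended to in order and at
  most one is discharged per stage.\<close>

primrec phase :: "nat set \<Rightarrow> nat set \<Rightarrow> nat set \<Rightarrow> nat \<Rightarrow> nat" where
  "phase A B C 0 = 0"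
| "phase A B C (Suc s) = phase A B C s + of_bool (witnessed A B C s (phase A B C s))"

lemma witnessed_cong:
  assumes "\<And>x. x < s \<Longrightarrow> x \<in> C \<longleftrightarrow> x \<in> D"
  shows "witnessed A B C s r \<longleftrightarrow> witnessed A B D s r"
proof -
  have "count_below C x = count_below D x" if "x < s" for x
    using that assms by (intro count_below_cong) auto
  then show ?thesis
    unfolding witnessed_def by (metis (no_types, lifting))
qed

lemma phase_cong:
  assumes "\<And>x. x < s \<Longrightarrow> x \<in> C \<longleftrightarrow> x \<in> D"
  shows "phase A B C s = phase A B D s"
  using assms
proof (induction s)
  case (Suc s)
  then have "witnessed A B C s r \<longleftrightarrow> witnessed A B D s r" for r
    by (intro witnessed_cong) auto
  with Suc show ?case by simp
qed simp

text \<open>While an even requirement is pending, \<open>C\<close> takes in every number as long as its count lags behind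
  that of \<open>B\<close>; while an odd one is pending, it takes in a number only when its count would otherwise
  drop below that of \<open>A\<close>. The rule refers to \<open>C\<close> itself, but only below \<open>s\<close>.\<close>

lemma interpolant_exists:
  assumes A: "prim_rec_set A" and B: "prim_rec_set B"
  obtains C where "prim_rec_set C"
    and "\<And>s. s \<in> C \<longleftrightarrow> count_below C s < count_below (if even (phase A B C s) then B else A) (Suc s)"
proof -
  define \<Phi> where "\<Phi> = (\<lambda>s C. if even (phase A B C s)
    then count_below C s < count_below B (Suc s) else count_below C s < count_below A (Suc s))"
  have phase: "phase A B C s = rec_nat 0 (\<lambda>s r. r + of_bool (witnessed A B C s r)) s" for C s
    by (induction s) auto
  have "pr_pred (\<lambda>v. \<Phi> (v 0) (set_decode (v 1)))"
    unfolding \<Phi>_def phase witnessed_def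
    by (intro pr_pred_if pr_pred_even pr_fun_rec pr_fun_add pr_fun_of_bool pr_pred_bounded_ex
        pr_pred_conj pr_pred_fast_eq pr_pred_less pr_fun_div pr_fun_count_below pr_pred_mem
        pr_pred_set_decode pr_fun_Suc pr_fun_var pr_fun_const A B)
  then obtain C where C: "prim_rec_set C" "\<And>s. s \<in> C \<longleftrightarrow> \<Phi> s (C \<inter> {..<s})"
    by (rule course_of_values_set) blast
  have "count_below (C \<inter> {..<s}) s = count_below C s" "phase A B (C \<inter> {..<s}) s = phase A B C s" for s
    by (rule count_below_cong, simp, rule phase_cong, simp)
  then have "s \<in> C \<longleftrightarrow> count_below C s < count_below (if even (phase A B C s) then B else A) (Suc s)" for s
    by (subst C(2)) (simp add: \<Phi>_def)
  then show thesis using C(1) that by blast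
qed

text \<open>The rule of \<open>interpolant_exists\<close> changes the count of \<open>C\<close> by at most one per stage and so keeps it
  between the counts of \<open>A\<close> and \<open>B\<close>. The point is that no requirement \<open>r\<close> stays pending from some
  stage \<open>s0\<close> on. If \<open>r\<close> is even, \<open>C\<close> would catch up with \<open>B\<close> up to a delay of \<open>s0\<close>, while the absence
  of witnesses gives \<open>C \<preceq> A\<close>. If \<open>r\<close> is odd, \<open>C\<close> would gain no elements until \<open>A\<close>, being infinite, has
  caught up, and would follow \<open>A\<close> afterwards, while the absence of witnesses gives \<open>B \<preceq> C\<close>. Either
  way \<open>B \<preceq> A\<close> would follow.\<close>

lemma strictly_between_exists:
  assumes A: "prim_rec_set A" and B: "prim_rec_set B" and "infinite A"
    and AB: "\<And>n. count_below A n \<le> count_below B n" and BA: "\<not> B \<preceq> A"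
  obtains C where "prim_rec_set C"
    and "\<And>n. count_below A n \<le> count_below C n" and "\<And>n. count_below C n \<le> count_below B n"
    and "\<not> C \<preceq> A" and "\<not> B \<preceq> C"
proof -
  obtain C where prC: "prim_rec_set C" and
    C: "\<And>s. s \<in> C \<longleftrightarrow> count_below C s < count_below (if even (phase A B C s) then B else A) (Suc s)"
    using interpolant_exists[OF A B] by blast
  have bounds: "count_below A s \<le> count_below C s \<and> count_below C s \<le> count_below B s" for s
  proof (induction s)
    case (Suc s)
    show ?case
      using Suc AB[of s] AB[of "Suc s"] C[of s]
      by (auto simp: of_bool_def split: if_splits)
  qed simp
  let ?phase = "phase A B C"
  have stuck: False if r: "\<And>s. s0 \<le> s \<Longrightarrow> ?phase s = r" for s0 r
  proof -
    \<comment> \<open>A witness stays valid at all later stages, so one at a stage after \<open>s0\<close> would end the phase.\<close>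
    have unwitnessed: "\<not> witnessed A B C s r" for s
    proof
      assume "witnessed A B C s r"
      then have "witnessed A B C (max s s0) r"
        unfolding witnessed_def by (auto simp: less_max_iff_disj)
      then show False
        using r[of "max s s0"] r[of "Suc (max s s0)"] by (simp add: le_SucI)
    qed
    let ?F = "fast (r div 2)"
    have no_witness: "\<not> (if even r then count_below A (?F x) < count_below C x
        else count_below C (?F x) < count_below B x)" for x
    proof -
      have "x < Suc (?F x)" using less_fast[of x "r div 2"] by simp
      then show ?thesis
        using unwitnessed[of "Suc (?F x)"] unfolding witnessed_def by blast
    qed
    show False
    proof (cases "even r")
      case True
      \<comment> \<open>From \<open>s0\<close> on the count of \<open>C\<close> increases by one at each stage at which it is behind \<open>B\<close>;
        as \<open>B\<close> has at most \<open>n\<close> elements below \<open>n\<close>, these are made up for by stage \<open>s0 + n\<close>.\<close>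
      have "min (count_below B (s0 + n)) n \<le> count_below C (s0 + n)" for n
      proof (induction n)
        case (Suc n)
        show ?case
          using Suc C[of "s0 + n"] r[of "s0 + n"] True by (auto simp: of_bool_def split: if_splits)
      qed simp
      moreover have "count_below B n \<le> min (count_below B (s0 + n)) n" for n
        using count_below_mono[of n "s0 + n" B] count_below_le[of B n] by simp
      ultimately have "count_below B n \<le> count_below C (s0 + n)" for n
        using order_trans by blast
      then have "count_below B n \<le> count_below C (n + s0)" for n
        by (simp only: add.commute)
      moreover have "count_below C x \<le> count_below A (?F x)" for x
        using no_witness[of x] True by (simp add: not_less)
      ultimately have "B \<preceq> A"
        by (intro embedsI_shift_argument) (rule order_trans)
      then show False using BA by simp
    next
      case False
      obtain k where k: "count_below C s0 \<le> count_below A k"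
        using count_below_unbounded[OF \<open>infinite A\<close>] by blast
      \<comment> \<open>\<open>C\<close> gains elements only in step with \<open>A\<close>, and the lead it has at \<open>s0\<close> is used up by
        stage \<open>k\<close>.\<close>
      have "count_below C (s0 + n) \<le> max (count_below C s0) (count_below A (s0 + n))" for n
      proof (induction n)
        case (Suc n)
        show ?case
          using Suc C[of "s0 + n"] r[of "s0 + n"] False by (auto simp: of_bool_def split: if_splits)
      qed simp
      then have C_le: "count_below C n \<le> count_below A (n + (s0 + k))" for n
      proof -
        have "count_below C n \<le> count_below C (s0 + n)"
          by (rule count_below_mono) simp
        also have "\<dots> \<le> max (count_below C s0) (count_below A (s0 + n))" by fact
        also have "\<dots> \<le> count_below A (n + (s0 + k))"
          using count_below_mono[of k "n + (s0 + k)" A] count_below_mono[of "s0 + n" "n + (s0 + k)" A] k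
          by simp
        finally show ?thesis .
      qed
      have "count_below B x \<le> count_below C (?F x)" for x
        using no_witness[of x] False by (simp add: not_less)
      then have "B \<preceq> A"
        using C_le by (intro embedsI_shift_value) (rule order_trans)
      then show False using BA by simp
    qed
  qed
  have advance: "\<exists>t. ?phase t = r \<and> ?phase (Suc t) = Suc r \<and> witnessed A B C t r"
    if "?phase s0 = r" for s0 r
  proof (rule ccontr)
    assume no: "\<not> ?thesis"
    have stay: "?phase (Suc t) = r" if t: "?phase t = r" for t
    proof -
      have "\<not> witnessed A B C t r"
      proof
        assume w: "witnessed A B C t r"
        then have "?phase (Suc t) = Suc r" by (simp add: t)
        with t w no show False by blast
      qed
      then show ?thesis by (simp add: t)
    qed
    have "?phase s = r" if "s0 \<le> s" for s
      using that
    proof (induction rule: dec_induct)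
      case base
      show ?case by fact
    next
      case (step t)
      then show ?case using stay by blast
    qed
    then show False by (rule stuck)
  qed
  have "\<exists>s. ?phase s = r" for r
  proof (induction r)
    case 0
    show ?case by (rule exI[of _ 0]) simp
  next
    case (Suc r)
    then show ?case using advance by blast
  qed
  then have phase_hits: "\<exists>s. witnessed A B C s r" for r
    using advance by blast
  have "\<not> C \<preceq> A"
  proof
    assume "C \<preceq> A"
    then obtain e where "\<And>n. count_below C n \<le> count_below A (fast e n)"
      unfolding embeds_def by blast
    moreover obtain x where "count_below A (fast e x) < count_below C x"
      using phase_hits[of "2 * e"] unfolding witnessed_def by auto
    ultimately show False
      using leD by blast
  qed
  moreover have "\<not> B \<preceq> C"
  proof
    assume "B \<preceq> C"
    then obtain e where "\<And>n. count_below B n \<le> count_below C (fast e n)"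
      unfolding embeds_def by blast
    moreover obtain x where "count_below C (fast e x) < count_below B x"
      using phase_hits[of "2 * e + 1"] unfolding witnessed_def by auto
    ultimately show False
      using leD by blast
  qed
  ultimately show thesis using that prC bounds by blast
qed

theorem theorem6p1:
  fixes X Z :: "nat set"
  assumes "punctual_equiv (collapse_rel X)"
    and "punctual_equiv (collapse_rel Z)"
    and "collapse_rel X <\<^sub>p\<^sub>r collapse_rel Z"
  shows "\<exists>Y :: nat set. prim_rec_set Y \<and>
    collapse_rel X <\<^sub>p\<^sub>r collapse_rel Y \<and> collapse_rel Y <\<^sub>p\<^sub>r collapse_rel Z"
proof -
  obtain X' where X': "X' \<noteq> {}" "collapse_rel X' = collapse_rel X"
    by (rule collapse_rel_nonempty_representative)
  obtain Z' where Z': "Z' \<noteq> {}" "collapse_rel Z' = collapse_rel Z"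
    by (rule collapse_rel_nonempty_representative)
  have prX: "prim_rec_set X'" and prZ: "prim_rec_set Z'"
    using prim_rec_set_if_punctual X' Z' assms(1,2) by simp_all
  have "infinite (- X')"
    using infinite_Compl_if_punctual[of X'] X' assms(1) by simp
  have XZ: "- X' \<preceq> - Z'" and ZX: "\<not> - Z' \<preceq> - X'"
    using assms(3) X' Z' prX prZ embeds_if_reducible[of X' Z'] reducible_if_embeds[of Z' X']
    by (auto simp: pr_strictly_reducible_def)
  obtain A where A: "prim_rec_set A" "- X' \<preceq> A" "A \<preceq> - X'"
    "\<And>n. count_below A n \<le> count_below (- Z') n"
    using pointwise_sparser_representative[OF prim_rec_set_Compl[OF prX] XZ] by blast
  have "infinite A"
    using \<open>infinite (- X')\<close> A(2) by (rule infinite_if_embeds)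
  moreover have "\<not> - Z' \<preceq> A"
    using ZX A(3) embeds_trans by blast
  ultimately obtain C where C: "prim_rec_set C" "\<not> C \<preceq> A" "\<not> - Z' \<preceq> C"
    "\<And>n. count_below A n \<le> count_below C n" "\<And>n. count_below C n \<le> count_below (- Z') n"
    using strictly_between_exists[OF A(1) prim_rec_set_Compl[OF prZ] _ A(4)] by blast
  define Y where "Y = - C"
  have prY: "prim_rec_set Y"
    unfolding Y_def using C(1) by (rule prim_rec_set_Compl)
  \<comment> \<open>\<open>C\<close> is not everything, since its count stays below that of the proper subset \<open>- Z'\<close>.\<close>
  have "Y \<noteq> {}"
  proof
    assume "Y = {}"
    then have "C = UNIV" by (auto simp: Y_def)
    obtain z where "z \<in> Z'" using Z'(1) by blast
    then show False
      using C(5)[of "Suc z"] count_below_le[of "- Z'" z] by (simp add: \<open>C = UNIV\<close> count_below_UNIV)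
  qed
  have "- X' \<preceq> - Y" "\<not> - Y \<preceq> - X'" "- Y \<preceq> - Z'" "\<not> - Z' \<preceq> - Y"
    using A(2) C(2,3) embeds_if_le[OF C(4)] embeds_if_le[OF C(5)] embeds_trans[of "- X'" A C]
      embeds_trans[of C "- X'" A] by (auto simp: Y_def)
  then have "collapse_rel X' <\<^sub>p\<^sub>r collapse_rel Y \<and> collapse_rel Y <\<^sub>p\<^sub>r collapse_rel Z'"
    unfolding pr_strictly_reducible_def
    using embeds_if_reducible[of Y X'] embeds_if_reducible[of Z' Y]
      reducible_if_embeds[of X' Y] reducible_if_embeds[of Y Z'] prX prY prZ X'(1) Z'(1) \<open>Y \<noteq> {}\<close>
    by blast
  then show ?thesis
    using prY X' Z' by auto
qed

end
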